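(* Consider distributed SGD run in stages, with the notation of the context. Given $t_{\tau-1}$, the switching time $t_\tau$ (at which the algorithm moves from stage $\tau$ to stage $\tau+1$) is given by $$t_\tau=t_{\tau-1}+\frac{\mu_\tau}{\alpha}\Big(-\log\big(\mu_\tau\,\eta L\sigma^2_{\text{grad}}(\phi_{\tau+1}-\phi_\tau)\big)+\log(\mu_{\tau+1}-\mu_\tau)+\log\big(\phi_{\tau+1}(2c\,\phi_\tau s\,e(t_{\tau-1})-\eta L\sigma^2_{\text{grad}})\big)\Big),$$ where $\alpha=-\log(1-\eta c)$.
   Context: A main node runs SGD with fixed learning rate $\eta$ using $n$ workers, each holding $s$ samples. The iterations are grouped into stages $\tau=1,2,\dots$. In stage $\tau$ the main node waits in each iteration for the $k_\tau$ fastest of the $n$ workers, and each worker uses a random batch of $\beta_\tau s$ of its samples, where $0<\beta_\tau\le 1$. A new stage is declared whenever $k$ and/or $\beta$ changes. Put $\phi_\tau=k_\tau\beta_\tau$; the scheme is designed so that $\phi_{\tau+1}>\phi_\tau$. Let $\mu_\tau=\mu_{k_\tau:n}(\beta_\tau)$ be the expectation of the $k_\tau$-th order statistic of the $n$ i.i.d. worker response times at batch scale $\beta_\tau$, i.e. the expected duration of one iteration of stage $\tau$. The constants $L$, $c$, $\sigma^2_{\text{grad}}$ are respectively the Lipschitz constant, the convexity parameter, and an upper bound on the variance of the gradient of the loss function. Let $F$ denote the loss, $F^\star$ the optimal loss, $\mathbf w_t$ the model at time $t$, and $e(t)=F(\mathbf w_t)-F^\star$. The expected gap $E(k,\beta,j)$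 to the optimal loss after $j$ iterations with parameters $k,\beta$ from the initial model $\mathbf w_0$ satisfies $$E(k,\beta,j)\le\frac{\eta L\sigma^2_{\text{grad}}}{2cks\beta}+(1-\eta c)^j\Big(F(\mathbf w_0)-F^\star-\frac{\eta L\sigma^2_{\text{grad}}}{2cks\beta}\Big).$$ In the analysis this bound is used as the value of the error, the iteration count is replaced by elapsed time divided by the expected iteration duration, and the initial error is replaced by the error at the start of the stage. The time of switching from stage $\tau$ to stage $\tau+1$ is denoted $t_\tau$, with $t_0=0$. The time $t_{\tau-1}$ and the parameters $k_{\tau+1},\beta_{\tau+1}$ of the next stage are known. The (optimal) switching time is determined by the criterion that the rate of decrease in time of the error with the parameters of stage $\tau+1$ (started at the switching time) exceeds that with the parameters of stage $\tau$ (started at $t_{\tau-1}$), i.e. $|\partial E(k_{\tau+1},\beta_{\tau+1},t)/\partial t|>|\partial E(k_\tau,\beta_\tau,t)/\partial t|$, evaluated at the switching time.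
   Formalization: The formula for the switching time is stated when the next stage is not already faster at the start of the current stage (otherwise it gives a time before that start), and when the arguments of all the logarithms are positive; the criterion is shown to hold exactly after the formula's time. *)

theory Defs
  imports "HOL-Probability.Probability"
begin

section \<open>Response times and order statistics\<close>

definition iid_response_times :: "'b measure \<Rightarrow> nat \<Rightarrow> (nat \<Rightarrow> 'b \<Rightarrow> real) \<Rightarrow> bool" where
  "iid_response_times M n X \<longleftrightarrow>
     prob_space.indep_vars M (\<lambda>_. borel) X {..<n} \<and>
     (\<forall>i<n. \<forall>j<n. distr M borel (X i) = distr M borel (X j)) \<and>
     (\<forall>i<n. integrable M (X i) \<and> (AE \<omega> in M. 0 < X i \<omega>))"

text \<open>The \<open>k\<close>-th smallest of \<open>X 0 \<omega>, \<dots>, X (n - 1) \<omega>\<close>; the rank \<open>k\<close> is counted from \<open>1\<close>.\<close>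

definition order_stat :: "nat \<Rightarrow> nat \<Rightarrow> (nat \<Rightarrow> 'b \<Rightarrow> real) \<Rightarrow> 'b \<Rightarrow> real" where
  "order_stat n k X \<omega> = sort (map (\<lambda>i. X i \<omega>) [0..<n]) ! (k - 1)"

definition mean_order_stat :: "'b measure \<Rightarrow> nat \<Rightarrow> nat \<Rightarrow> (nat \<Rightarrow> 'b \<Rightarrow> real) \<Rightarrow> real" where
  "mean_order_stat M n k X = (\<integral>\<omega>. order_stat n k X \<omega> \<partial>M)"

section \<open>Loss function\<close>

definition strongly_convex :: "real \<Rightarrow> ('a::real_inner \<Rightarrow> real) \<Rightarrow> ('a \<Rightarrow> 'a) \<Rightarrow> bool" where
  "strongly_convex c F gF \<longleftrightarrow>
     (\<forall>v v'. F v' \<ge> F v + gF v \<bullet> (v' - v) + c / 2 * (norm (v' - v))\<^sup>2)"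

text \<open>\<open>G v\<close> is a random estimate of the gradient \<open>gF v\<close>, with randomness drawn from \<open>N\<close>:
  it is unbiased and its variance is at most \<open>\<sigma>2\<close>.\<close>

definition stochastic_gradient ::
  "'d measure \<Rightarrow> ('a::euclidean_space \<Rightarrow> 'd \<Rightarrow> 'a) \<Rightarrow> ('a \<Rightarrow> 'a) \<Rightarrow> real \<Rightarrow> bool" where
  "stochastic_gradient N G gF \<sigma>2 \<longleftrightarrow>
     prob_space N \<and>
     (\<forall>v. integrable N (G v) \<and> (\<integral>x. G v x \<partial>N) = gF v \<and>
          integrable N (\<lambda>x. (norm (G v x - gF v))\<^sup>2) \<and>
          (\<integral>x. (norm (G v x - gF v))\<^sup>2 \<partial>N) \<le> \<sigma>2)"

definition optimality_gap :: "('a \<Rightarrow> real) \<Rightarrow> 'a \<Rightarrow> real" where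
  "optimality_gap F v = F v - (INF u. F u)"

section \<open>Error model and switching criterion\<close>

text \<open>Value of the convergence bound of fixed-rate SGD after \<open>j\<close> iterations with \<open>k\<close> awaited
  workers, \<open>s\<close> samples per worker and batch scale \<open>b\<close>, starting from the gap \<open>e\<^sub>0\<close>.  The number of
  iterations is real, because it gets replaced by elapsed time over mean iteration duration.\<close>

definition sgd_error ::
  "real \<Rightarrow> real \<Rightarrow> real \<Rightarrow> real \<Rightarrow> nat \<Rightarrow> real \<Rightarrow> nat \<Rightarrow> real \<Rightarrow> real \<Rightarrow> real" where
  "sgd_error \<eta> L c \<sigma>2 s e\<^sub>0 k b j =
     \<eta> * L * \<sigma>2 / (2 * c * real k * real s * b) +
     (1 - \<eta> * c) powr j * (e\<^sub>0 - \<eta> * L * \<sigma>2 / (2 * c * real k * real s * b))"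

text \<open>In the following, \<open>E e d\<close> and \<open>E' e d\<close> are the errors at elapsed time \<open>d\<close> under the
  parameters of the current and of the next stage, when started with error \<open>e\<close>.  The current stage
  starts at time \<open>a\<close> with error \<open>e\<close>.  A switch at time \<open>u\<close> starts the next stage at \<open>u\<close> with the
  error that the current stage has reached by then.\<close>

definition next_stage_faster ::
  "(real \<Rightarrow> real \<Rightarrow> real) \<Rightarrow> (real \<Rightarrow> real \<Rightarrow> real) \<Rightarrow> real \<Rightarrow> real \<Rightarrow> real \<Rightarrow> bool" where
  "next_stage_faster E E' a e u \<longleftrightarrow>
     \<bar>deriv (\<lambda>t. E' (E e (u - a)) (t - u)) u\<bar> > \<bar>deriv (\<lambda>t. E e (t - a)) u\<bar>"

text \<open>The earliest time at which the criterion holds.  It is an infimum and not a minimum, because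
  the criterion is a strict inequality.\<close>

definition switching_time ::
  "(real \<Rightarrow> real \<Rightarrow> real) \<Rightarrow> (real \<Rightarrow> real \<Rightarrow> real) \<Rightarrow> real \<Rightarrow> real \<Rightarrow> real" where
  "switching_time E E' a e = Inf {u. a \<le> u \<and> next_stage_faster E E' a e u}"

end

theory Submission
  imports Defs
begin

text \<open>Both error curves are exponentials: with \<open>x\<close> the factor by which the current stage has shrunk its
  excess \<open>\<Delta>\<close> over its own floor \<open>B\<close>, the decrease rates are \<open>\<alpha> * x * \<Delta> / m\<close> for the current stage and
  \<open>\<alpha> * (B + x * \<Delta> - B') / m'\<close> for the next one, whose floor \<open>B'\<close> is lower.  Hence the next stage is
  faster iff \<open>x\<close> lies below a threshold, that is, iff the time lies beyond one.  Mean iteration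
  durations are positive because order statistics of integrable, almost surely positive times are
  again integrable and almost surely positive.\<close>

text \<open>The entries at most \<open>x\<close> form an initial segment of a sorted list, so their
  number alone decides on which side of \<open>x\<close> position \<open>j\<close> falls.\<close>

lemma sorted_nth_le_iff:
  fixes ys :: "'a::linorder list"
  assumes "sorted ys" and "j < length ys"
  shows "ys ! j \<le> x \<longleftrightarrow> j < length (filter (\<lambda>y. y \<le> x) ys)"
  using assms
proof (induction ys arbitrary: j)
  case Nil
  then show ?case by simp
next
  case (Cons y ys)
  show ?case
  proof (cases "y \<le> x")
    case True
    then show ?thesis using Cons by (cases j) auto
  next
    case False
    then have "filter (\<lambda>y. y \<le> x) (y # ys) = []"
      using Cons.prems(1) by (auto simp: filter_empty_conv)
    moreover have "y \<le> (y # ys) ! j"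
      using Cons.prems by (cases j) auto
    ultimately show ?thesis using False by auto
  qed
qed

lemma order_stat_mem:
  assumes "1 \<le> k" and "k \<le> n"
  shows "\<exists>i<n. order_stat n k X \<omega> = X i \<omega>"
proof -
  have "order_stat n k X \<omega> \<in> set (sort (map (\<lambda>i. X i \<omega>) [0..<n]))"
    unfolding order_stat_def using assms by (intro nth_mem) simp
  then obtain i where "i < n" "order_stat n k X \<omega> = X i \<omega>"
    by (auto simp only: set_sort set_map set_upt atLeastLessThan_iff)
  then show ?thesis by blast
qed

text \<open>Trades sorting for a finite sum of indicators, from which the measurability of the
  sublevel sets is immediate.\<close>

lemma order_stat_le_iff:
  assumes "1 \<le> k" and "k \<le> n"
  shows "order_stat n k X \<omega> \<le> x \<longleftrightarrow> real k \<le> (\<Sum>i<n. if X i \<omega> \<le> x then 1 else 0)"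
proof -
  let ?xs = "map (\<lambda>i. X i \<omega>) [0..<n]"
  have "order_stat n k X \<omega> \<le> x \<longleftrightarrow> k - 1 < length (filter (\<lambda>y. y \<le> x) (sort ?xs))"
    unfolding order_stat_def using assms by (intro sorted_nth_le_iff) auto
  also have "length (filter (\<lambda>y. y \<le> x) (sort ?xs)) = length (filter (\<lambda>y. y \<le> x) ?xs)"
    by (simp add: filter_sort)
  also have "\<dots> = card {i. i < n \<and> X i \<omega> \<le> x}"
    unfolding length_filter_conv_card by (rule arg_cong[where f = card]) auto
  also have "{i. i < n \<and> X i \<omega> \<le> x} = {..<n} \<inter> {i. X i \<omega> \<le> x}"
    by auto
  \<comment> \<open>Rank \<open>k\<close> sits at position \<open>k - 1\<close>, which turns the
    strict inequality into a weak one; \<open>1 \<le> k\<close> keeps the subtraction from being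
    truncated.\<close>
  finally have "order_stat n k X \<omega> \<le> x \<longleftrightarrow> k \<le> card ({..<n} \<inter> {i. X i \<omega> \<le> x})"
    using assms by linarith
  then show ?thesis
    by (simp add: sum.If_cases)
qed

lemma borel_measurable_order_stat:
  assumes "1 \<le> k" and "k \<le> n" and [measurable]: "\<And>i. i < n \<Longrightarrow> X i \<in> borel_measurable M"
  shows "order_stat n k X \<in> borel_measurable M"
  unfolding borel_measurable_iff_le
proof
  fix x
  have "(\<lambda>\<omega>. \<Sum>i<n. if X i \<omega> \<le> x then 1 else 0 :: real) \<in> borel_measurable M"
    by measurable
  then show "{\<omega> \<in> space M. order_stat n k X \<omega> \<le> x} \<in> sets M"
    unfolding order_stat_le_iff[OF assms(1,2)] by measurable
qed

text \<open>Pointwise the order statistic is one of the \<open>X i\<close>, hence dominated by the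
  sum of all their absolute values.\<close>

lemma integrable_order_stat:
  assumes "1 \<le> k" and "k \<le> n" and int: "\<And>i. i < n \<Longrightarrow> integrable M (X i)"
  shows "integrable M (order_stat n k X)"
proof (rule Bochner_Integration.integrable_bound)
  show "integrable M (\<lambda>\<omega>. \<Sum>i<n. \<bar>X i \<omega>\<bar>)"
    using int by (intro Bochner_Integration.integrable_sum integrable_abs) auto
  show "order_stat n k X \<in> borel_measurable M"
    using assms by (intro borel_measurable_order_stat) auto
  show "AE \<omega> in M. norm (order_stat n k X \<omega>) \<le> norm (\<Sum>i<n. \<bar>X i \<omega>\<bar>)"
  proof (intro AE_I2)
    fix \<omega>
    obtain i where i: "i < n" "order_stat n k X \<omega> = X i \<omega>"
      using order_stat_mem[OF assms(1,2), of X \<omega>] by blast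
    have "\<bar>X i \<omega>\<bar> \<le> (\<Sum>i<n. \<bar>X i \<omega>\<bar>)"
      by (rule member_le_sum) (use i in auto)
    then show "norm (order_stat n k X \<omega>) \<le> norm (\<Sum>i<n. \<bar>X i \<omega>\<bar>)"
      using i by simp
  qed
qed

lemma mean_order_stat_pos:
  assumes "prob_space M" and iid: "iid_response_times M n X" and k: "1 \<le> k" "k \<le> n"
  shows "0 < mean_order_stat M n k X"
proof -
  interpret prob_space M by fact
  have int: "\<And>i. i < n \<Longrightarrow> integrable M (X i)"
    and pos: "\<And>i. i < n \<Longrightarrow> AE \<omega> in M. 0 < X i \<omega>"
    using iid by (auto simp: iid_response_times_def)
  have "AE \<omega> in M. \<forall>i\<in>{..<n}. 0 < X i \<omega>"
    using pos by (intro AE_finite_allI) auto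
  then have "AE \<omega> in M. 0 < order_stat n k X \<omega>"
  proof eventually_elim
    case (elim \<omega>)
    then show ?case using order_stat_mem[OF k, of X \<omega>] by auto
  qed
  \<comment> \<open>Almost sure strict inequality passes to the integrals because the space has
    nonzero mass.\<close>
  then have "(\<integral>\<omega>. 0 \<partial>M) < (\<integral>\<omega>. order_stat n k X \<omega> \<partial>M)"
    using integrable_order_stat[OF k int] by (intro integral_less_AE_space) (auto simp: emeasure_space_1)
  then show ?thesis
    by (simp add: mean_order_stat_def)
qed

text \<open>The excess over the floor is an exponential in time, so its derivative is a constant
  multiple of the excess itself.\<close>

lemma deriv_sgd_error:
  assumes "\<eta> * c < 1"
  shows "deriv (\<lambda>t. sgd_error \<eta> L c \<sigma>2 s e\<^sub>0 k b ((t - a) / m)) u =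
    ln (1 - \<eta> * c) / m * (sgd_error \<eta> L c \<sigma>2 s e\<^sub>0 k b ((u - a) / m)
      - \<eta> * L * \<sigma>2 / (2 * c * real k * real s * b))"
proof (cases "m = 0")
  \<comment> \<open>Division by zero yields zero: the error is constant in \<open>t\<close>, and the
    right-hand side vanishes too.\<close>
  case True
  then show ?thesis by simp
next
  case False
  then show ?thesis
    using assms unfolding sgd_error_def powr_def
    by (intro DERIV_imp_deriv) (auto intro!: derivative_eq_intros)
qed

text \<open>Compares the two decrease rates without their common factor \<alpha>. Clearing the
  denominators \<open>K * \<phi> * \<phi>'\<close>, \<open>m\<close> and \<open>m'\<close> and
  collecting the terms in \<open>x\<close> isolates the shrinking factor on the left.\<close>

lemma decrease_rate_less_iff:
  fixes m m' A K \<phi> \<phi>' g x :: real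
  assumes "0 < m" "0 < m'" "0 < K" "0 < \<phi>" "0 < \<phi>'"
  shows "x * (g - A / (K * \<phi>)) / m
      < (A / (K * \<phi>) + x * (g - A / (K * \<phi>)) - A / (K * \<phi>')) / m'
    \<longleftrightarrow> x * ((m' - m) * (\<phi>' * (K * \<phi> * g - A))) < m * A * (\<phi>' - \<phi>)"
proof -
  define D where "D = K * \<phi> * g - A"
  have g: "g - A / (K * \<phi>) = D / (K * \<phi>)"
    using assms by (simp add: D_def field_simps)
  have AA: "A / (K * \<phi>) = A * \<phi>' / (K * \<phi> * \<phi>')" "A / (K * \<phi>') = A * \<phi> / (K * \<phi> * \<phi>')"
    "D / (K * \<phi>) = D * \<phi>' / (K * \<phi> * \<phi>')"
    using assms by auto
  define P where "P = K * \<phi> * \<phi>'"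
  have P: "0 < P" using assms by (simp add: P_def)
  \<comment> \<open>Moves the common positive divisor \<open>P\<close> outermost, where it
    cancels.\<close>
  have div_P: "v / P / l = v / l / P" for v l
    by (simp add: mult.commute)
  have "x * (D * \<phi>' / P) / m < (A * \<phi>' / P + x * (D * \<phi>' / P) - A * \<phi> / P) / m'
    \<longleftrightarrow> (x * (D * \<phi>')) / P / m < (A * \<phi>' + x * (D * \<phi>') - A * \<phi>) / P / m'"
    by (simp add: add_divide_distrib diff_divide_distrib)
  also have "\<dots> \<longleftrightarrow> x * (D * \<phi>') / m < (A * \<phi>' + x * (D * \<phi>') - A * \<phi>) / m'"
    unfolding div_P using P by (simp only: divide_less_cancel) auto
  also have "\<dots> \<longleftrightarrow> x * (D * \<phi>') * m' < (A * \<phi>' + x * (D * \<phi>') - A * \<phi>) * m"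
    using assms by (simp add: frac_less_eq pos_divide_less_eq pos_less_divide_eq mult.commute)
  also have "\<dots> \<longleftrightarrow> x * ((m' - m) * (\<phi>' * D)) < m * A * (\<phi>' - \<phi>)"
    by (simp add: algebra_simps)
  finally show ?thesis
    unfolding g unfolding AA P_def[symmetric] D_def[symmetric] .
qed

text \<open>Solves for the elapsed time \<open>d\<close> by taking logarithms. Since
  \<open>q < 1\<close>, the exponent has the negative coefficient \<open>ln q / m\<close>, so an
  upper bound on the power becomes a lower bound on \<open>d\<close>.\<close>

lemma powr_mult_less_iff:
  fixes q m d p\<^sub>1 p\<^sub>2 r :: real
  assumes "0 < q" "q < 1" "0 < m" "0 < p\<^sub>1" "0 < p\<^sub>2" "0 < r"
  shows "q powr (d / m) * (p\<^sub>1 * p\<^sub>2) < r \<longleftrightarrow> m / (- ln q) * (- ln r + ln p\<^sub>1 + ln p\<^sub>2) < d"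
proof -
  have "q powr (d / m) * (p\<^sub>1 * p\<^sub>2) < r \<longleftrightarrow> ln (q powr (d / m) * (p\<^sub>1 * p\<^sub>2)) < ln r"
    using assms by simp
  also have "\<dots> \<longleftrightarrow> - ln r + ln p\<^sub>1 + ln p\<^sub>2 < d * (- ln q / m)"
    using assms by (auto simp: ln_mult ln_powr)
  also have "\<dots> \<longleftrightarrow> m / (- ln q) * (- ln r + ln p\<^sub>1 + ln p\<^sub>2) < d"
  proof -
    have "0 < - ln q" using assms by simp
    then show ?thesis using assms by (simp add: field_simps)
  qed
  finally show ?thesis .
qed

theorem theorem2:
  fixes M :: "'b measure" and R :: "real \<Rightarrow> nat \<Rightarrow> 'b \<Rightarrow> real"
    and n s :: nat and k :: "nat \<Rightarrow> nat" and \<beta> \<phi> \<mu> t :: "nat \<Rightarrow> real"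
    and \<eta> L c \<sigma>2 \<alpha> :: real
    and F :: "'a::euclidean_space \<Rightarrow> real" and gF :: "'a \<Rightarrow> 'a"
    and N :: "'d measure" and G :: "'a \<Rightarrow> 'd \<Rightarrow> 'a"
    and w :: "real \<Rightarrow> 'a" and e :: "real \<Rightarrow> real"
    and E :: "nat \<Rightarrow> real \<Rightarrow> real \<Rightarrow> real" and \<tau> :: nat
  assumes "prob_space M"
    and "\<And>b. 0 < b \<Longrightarrow> b \<le> 1 \<Longrightarrow> iid_response_times M n (R b)"
    and "\<And>v. GDERIV F v :> gF v"
    and "L-lipschitz_on UNIV gF"
    and "strongly_convex c F gF"
    and "stochastic_gradient N G gF \<sigma>2"
    and "0 < \<eta>" and "0 < L" and "0 < c" and "0 < \<sigma>2" and "\<eta> * c < 1" and "0 < s"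
    and "1 \<le> \<tau>"
    and "\<And>i. i \<in> {\<tau>, \<tau> + 1} \<Longrightarrow> 1 \<le> k i \<and> k i \<le> n \<and> 0 < \<beta> i \<and> \<beta> i \<le> 1"
    and "\<And>i. \<phi> i = real (k i) * \<beta> i"
    and "\<And>i. \<mu> i = mean_order_stat M n (k i) (R (\<beta> i))"
    and "\<And>u. e u = optimality_gap F (w u)"
    and "\<And>i e\<^sub>0 d. E i e\<^sub>0 d = sgd_error \<eta> L c \<sigma>2 s e\<^sub>0 (k i) (\<beta> i) (d / \<mu> i)"
    and "\<phi> \<tau> < \<phi> (\<tau> + 1)"
    and "\<mu> \<tau> < \<mu> (\<tau> + 1)"
    and "2 * c * \<phi> \<tau> * real s * e (t (\<tau> - 1)) > \<eta> * L * \<sigma>2"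
    and "t 0 = 0"
    and "t \<tau> = switching_time (E \<tau>) (E (\<tau> + 1)) (t (\<tau> - 1)) (e (t (\<tau> - 1)))"
    and "\<alpha> = - ln (1 - \<eta> * c)"
  shows "let T = t (\<tau> - 1) + \<mu> \<tau> / \<alpha> *
               (- ln (\<mu> \<tau> * \<eta> * L * \<sigma>2 * (\<phi> (\<tau> + 1) - \<phi> \<tau>))
                + ln (\<mu> (\<tau> + 1) - \<mu> \<tau>)
                + ln (\<phi> (\<tau> + 1) * (2 * c * \<phi> \<tau> * real s * e (t (\<tau> - 1)) - \<eta> * L * \<sigma>2)))
         in (\<forall>u. next_stage_faster (E \<tau>) (E (\<tau> + 1)) (t (\<tau> - 1)) (e (t (\<tau> - 1))) u \<longleftrightarrow> T < u) \<and>
            (\<not> next_stage_faster (E \<tau>) (E (\<tau> + 1)) (t (\<tau> - 1)) (e (t (\<tau> - 1))) (t (\<tau> - 1))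
               \<longrightarrow> t \<tau> = T)"
proof -
  define a where "a = t (\<tau> - 1)"
  define g where "g = e a"
  define q where "q = 1 - \<eta> * c"
  \<comment> \<open>With \<open>A\<close> and \<open>K\<close> the floor of stage \<open>i\<close>
    is \<open>A / (K * \<phi> i)\<close>, which depends on \<open>k i\<close> and
    \<open>\<beta> i\<close> only through their product.\<close>
  define A where "A = \<eta> * L * \<sigma>2"
  define K where "K = 2 * c * real s"
  define T where "T = a + \<mu> \<tau> / \<alpha> *
    (- ln (\<mu> \<tau> * A * (\<phi> (\<tau> + 1) - \<phi> \<tau>)) + ln (\<mu> (\<tau> + 1) - \<mu> \<tau>)
     + ln (\<phi> (\<tau> + 1) * (K * \<phi> \<tau> * g - A)))"
  let ?faster = "next_stage_faster (E \<tau>) (E (\<tau> + 1)) a g"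
  have q: "0 < q" "q < 1"
    using assms(7,9,11) by (auto simp: q_def)
  have pos: "0 < A" "0 < K"
    using assms(7-12) by (auto simp: A_def K_def)
  have stage: "1 \<le> k \<tau>" "k \<tau> \<le> n" "0 < \<beta> \<tau>" "\<beta> \<tau> \<le> 1"
    using assms(14)[of \<tau>] by auto
  have \<phi>: "0 < \<phi> \<tau>" "\<phi> \<tau> < \<phi> (\<tau> + 1)"
    using stage assms(15,19) by auto
  have \<mu>: "0 < \<mu> \<tau>" "\<mu> \<tau> < \<mu> (\<tau> + 1)"
    using mean_order_stat_pos[OF assms(1) assms(2)] stage assms(16,20) by auto
  \<comment> \<open>The stage starts above its own floor; this also makes the argument of the last
    logarithm in \<open>T\<close> positive.\<close>
  have g: "A < K * \<phi> \<tau> * g"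
    using assms(21) by (simp add: A_def K_def g_def a_def mult_ac)
  have floor: "\<eta> * L * \<sigma>2 / (2 * c * real (k i) * real s * \<beta> i) = A / (K * \<phi> i)" for i
    by (simp add: A_def K_def assms(15) mult_ac)
  have E: "E i h d = A / (K * \<phi> i) + q powr (d / \<mu> i) * (h - A / (K * \<phi> i))" for i h d
    unfolding assms(18) sgd_error_def floor q_def ..
  have deriv_E: "deriv (\<lambda>v. E i h (v - b)) u = ln q / \<mu> i * (E i h (u - b) - A / (K * \<phi> i))"
    for i h b u
    unfolding assms(18) deriv_sgd_error[OF assms(11)] floor q_def ..
  have faster: "?faster u \<longleftrightarrow> T < u" for u
  proof -
    define x where "x = q powr ((u - a) / \<mu> \<tau>)"
    define y where "y = x * (g - A / (K * \<phi> \<tau>))"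
    \<comment> \<open>\<open>y\<close> and \<open>z\<close> are the excesses of the error at time
      \<open>u\<close> over the current and the next floor.\<close>
    define z where "z = A / (K * \<phi> \<tau>) + y - A / (K * \<phi> (\<tau> + 1))"
    have x: "0 < x" using q by (simp add: x_def)
    have y: "0 < y"
      using g pos \<phi> x by (auto simp: y_def field_simps)
    have "A / (K * \<phi> (\<tau> + 1)) < A / (K * \<phi> \<tau>)"
      using pos \<phi> by (intro divide_strict_left_mono mult_strict_left_mono mult_pos_pos) auto
    then have z: "0 < z" using y by (simp add: z_def)
    have lnq: "ln q < 0" using q by simp
    have d1: "deriv (\<lambda>v. E \<tau> g (v - a)) u = ln q * (y / \<mu> \<tau>)"
      unfolding deriv_E by (simp add: E x_def y_def)
    \<comment> \<open>At \<open>u\<close> the next stage has run for time 0, and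
      \<open>q powr 0 = 1\<close> for positive \<open>q\<close>, so its error there is the gap it
      took over.\<close>
    have d2: "deriv (\<lambda>v. E (\<tau> + 1) (E \<tau> g (u - a)) (v - u)) u = ln q * (z / \<mu> (\<tau> + 1))"
      unfolding deriv_E using q by (simp add: E x_def y_def z_def)
    have "\<bar>y / \<mu> \<tau>\<bar> = y / \<mu> \<tau>" "\<bar>z / \<mu> (\<tau> + 1)\<bar> = z / \<mu> (\<tau> + 1)"
      using y z \<mu> by auto
    then have "?faster u \<longleftrightarrow> y / \<mu> \<tau> < z / \<mu> (\<tau> + 1)"
      unfolding next_stage_faster_def d1 d2 abs_mult using lnq
      by (simp only: mult_less_cancel_left_pos zero_less_abs_iff less_imp_neq not_False_eq_True)
    also have "\<dots> \<longleftrightarrow> x * ((\<mu> (\<tau> + 1) - \<mu> \<tau>) * (\<phi> (\<tau> + 1) * (K * \<phi> \<tau> * g - A)))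
        < \<mu> \<tau> * A * (\<phi> (\<tau> + 1) - \<phi> \<tau>)"
      unfolding y_def z_def by (rule decrease_rate_less_iff) (use \<mu> pos \<phi> in auto)
    \<comment> \<open>The two factors split off by the logarithm are
      \<open>\<mu> (\<tau> + 1) - \<mu> \<tau>\<close> and
      \<open>\<phi> (\<tau> + 1) * (K * \<phi> \<tau> * g - A)\<close>.\<close>
    also have "\<dots> \<longleftrightarrow> T - a < u - a"
      unfolding x_def T_def assms(24) q_def[symmetric]
      by (subst powr_mult_less_iff) (use q \<mu> pos \<phi> g in auto)
    finally show ?thesis by simp
  qed
  \<comment> \<open>Failure of the criterion at the start means \<open>a \<le> T\<close>, so the
    admissible times form an open ray with unattained infimum \<open>T\<close>. Otherwise
    \<open>T < a\<close>, and the infimum would be \<open>a\<close>.\<close>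
  have "t \<tau> = T" if "\<not> ?faster a"
  proof -
    have "a \<le> T"
      using that unfolding faster by simp
    then have "{u. a \<le> u \<and> ?faster u} = {T<..}"
      unfolding faster by auto
    then have "switching_time (E \<tau>) (E (\<tau> + 1)) a g = T"
      unfolding switching_time_def by (simp only: cInf_greaterThan)
    then show ?thesis
      unfolding assms(23) a_def g_def .
  qed
  moreover have "T = t (\<tau> - 1) + \<mu> \<tau> / \<alpha> *
      (- ln (\<mu> \<tau> * \<eta> * L * \<sigma>2 * (\<phi> (\<tau> + 1) - \<phi> \<tau>)) + ln (\<mu> (\<tau> + 1) - \<mu> \<tau>)
       + ln (\<phi> (\<tau> + 1) * (2 * c * \<phi> \<tau> * real s * e (t (\<tau> - 1)) - \<eta> * L * \<sigma>2)))"
    unfolding T_def A_def K_def g_def a_def by (simp only: mult_ac)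
  ultimately show ?thesis
    using faster unfolding Let_def a_def g_def by metis
qed

end
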